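(* Let $K$ be a field, $R=K[x_1,\ldots,x_n]$, let $v_1,\ldots,v_q\in\mathbb{N}^n$, let $A$ be the $n\times q$ matrix with column vectors $v_1,\ldots,v_q$, assume that all rows and all columns of $A$ are nonzero, and let $I=(x^{v_1},\ldots,x^{v_q})\subset R$. Let $Q=Q(A)=\{x\in\mathbb{R}^n\mid x\geq 0;\ xA\geq\mathbf{1}\}$ and let $B(Q)$ be its blocking polyhedron. Then the ideal $I$ is normal if and only if $B(Q)$ has the integer decomposition property and all minimal integer vectors of $B(Q)$ (that is, the elements of $B(Q)\cap\mathbb{Z}^n$ that are minimal with respect to the componentwise order $\leq$) are columns of $A$.
   Context: $x^a:=x_1^{a_1}\cdots x_n^{a_n}$ for $a=(a_1,\ldots,a_n)\in\mathbb{N}^n$, $\mathbb{N}=\{0,1,2,\ldots\}$; $\mathbf{1}$ is the vector with all entries equal to $1$; vector inequalities are componentwise; $\langle\,,\rangle$ is the standard inner product. The integral closure of $I^i$ is $\overline{I^i}=(\{x^a\in R\mid \exists\, p\geq 1:\ (x^a)^p\in I^{pi}\})$. The monomial ideal $I$ is normal if $I^i=\overline{I^i}$ for all $i\geq 1$. For a rational polyhedron $Q\subset\mathbb{R}^n$, its blocking polyhedron is $B(Q)=\{z\in\mathbb{R}^n\mid z\geq 0;\ \langle z,x\rangle\geq 1\text{ for all }x\in Q\}$. A rational polyhedron $Q$ has the integer decomposition property if for each positive integer $k$ and each integer vector $a\in kQ=\{ky\mid y\in Q\}$, $a$ is the sum of $k$ integer vectors in $Q$. *)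

theory Defs
  imports "HOL-Analysis.Analysis" "HOL-Library.Poly_Mapping"
begin

text \<open>
  The polynomial ring $K[x_1,\ldots,x_n]$ is the monoid algebra of finitely supported
  functions from exponent vectors to $K$, with the convolution product of
  \<^theory>\<open>HOL-Library.Poly_Mapping\<close>. The variables are indexed by the finite type \<open>'n\<close>.
\<close>

type_synonym ('k, 'n) mpoly = "(nat ^ 'n) \<Rightarrow>\<^sub>0 'k"

definition var :: "'n::finite \<Rightarrow> ('k::field, 'n) mpoly" where
  "var i = Poly_Mapping.single (axis i 1) 1"

definition xpow :: "nat ^ 'n::finite \<Rightarrow> ('k::field, 'n) mpoly" where
  "xpow a = (\<Prod>i\<in>UNIV. var i ^ (a $ i))"

lemma xpow_eq_single: "xpow a = (Poly_Mapping.single a 1 :: ('k::field, 'n::finite) mpoly)"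
proof -
  have pow: "var i ^ m = (Poly_Mapping.single (axis i m) 1 :: ('k, 'n) mpoly)" for i :: 'n and m
  proof (induction m)
    case 0
    have "axis i 0 = (0 :: nat ^ 'n)"
      by (simp add: axis_def vec_eq_iff)
    then show ?case by (simp add: single_one del: axis_eq_0_iff)
  next
    case (Suc m)
    have "axis i 1 + axis i m = (axis i (Suc m) :: nat ^ 'n)"
      by (simp add: axis_def vec_eq_iff)
    with Suc show ?case by (simp add: var_def mult_single)
  qed
  have fin: "(\<Prod>i\<in>S. Poly_Mapping.single (f i) 1) =
      (Poly_Mapping.single (\<Sum>i\<in>S. f i) 1 :: ('k, 'n) mpoly)"
    if "finite S" for S :: "'n set" and f :: "'n \<Rightarrow> nat ^ 'n"
    using that by (induction S rule: finite_induct) (simp_all add: mult_single)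
  have "(\<Sum>i\<in>UNIV. axis i (a $ i)) = a"
    by (simp add: vec_eq_iff axis_def)
  then show ?thesis
    by (simp add: xpow_def pow fin)
qed

text \<open>
  An ideal is a submodule of the ring regarded as a module over itself, so the ideal
  generated by a set is its linear span with ring coefficients.
\<close>

definition ideal_gen :: "'a::comm_ring_1 set \<Rightarrow> 'a set" where
  "ideal_gen S = module.span (*) S"

lemma module_self: "module ((*) :: 'a::comm_ring_1 \<Rightarrow> 'a \<Rightarrow> 'a)"
  by standard (simp_all add: algebra_simps)

definition ideal_mult :: "'a::comm_ring_1 set \<Rightarrow> 'a set \<Rightarrow> 'a set" where
  "ideal_mult I J = ideal_gen {f * g | f g. f \<in> I \<and> g \<in> J}"

primrec ideal_power :: "'a::comm_ring_1 set \<Rightarrow> nat \<Rightarrow> 'a set" where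
  "ideal_power I 0 = UNIV"
| "ideal_power I (Suc i) = ideal_mult I (ideal_power I i)"

text \<open>
  This is the integral closure of $I^i$ only when $I$ is a monomial ideal: then that closure
  is again a monomial ideal, generated by the monomials having a power in $(I^i)^p = I^{pi}$.
\<close>

definition integral_closure_power ::
  "('k::field, 'n::finite) mpoly set \<Rightarrow> nat \<Rightarrow> ('k, 'n) mpoly set" where
  "integral_closure_power I i =
     ideal_gen {xpow a | a. \<exists>p\<ge>1. xpow a ^ p \<in> ideal_power I (p * i)}"

definition normal_ideal :: "('k::field, 'n::finite) mpoly set \<Rightarrow> bool" where
  "normal_ideal I \<longleftrightarrow> (\<forall>i\<ge>1. ideal_power I i = integral_closure_power I i)"

text \<open>
  The order on \<^typ>\<open>real ^ 'n\<close> is componentwise, and \<open>1\<close> is the all-ones vector.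
\<close>

definition covering_polyhedron :: "real ^ 'q ^ 'n \<Rightarrow> (real ^ 'n) set" where
  "covering_polyhedron A = {x. 0 \<le> x \<and> 1 \<le> x v* A}"

definition blocking_polyhedron :: "(real ^ 'n) set \<Rightarrow> (real ^ 'n) set" where
  "blocking_polyhedron Q = {z. 0 \<le> z \<and> (\<forall>x\<in>Q. 1 \<le> z \<bullet> x)}"

definition integer_vectors :: "(real ^ 'n) set" where
  "integer_vectors = {z. \<forall>i. z $ i \<in> \<int>}"

text \<open>
  The notion is meant for rational polyhedra, but its defining condition makes sense
  for every set of vectors.
\<close>

definition integer_decomposition_property :: "(real ^ 'n) set \<Rightarrow> bool" where
  "integer_decomposition_property Q \<longleftrightarrow>
     (\<forall>k::nat. \<forall>a. 1 \<le> k \<and> a \<in> integer_vectors \<and> a \<in> (\<lambda>y. real k *\<^sub>R y) ` Q \<longrightarrow>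
        (\<exists>b :: nat \<Rightarrow> real ^ 'n.
           (\<forall>j<k. b j \<in> integer_vectors \<inter> Q) \<and> a = (\<Sum>j<k. b j)))"

definition minimal_integer_vectors :: "(real ^ 'n) set \<Rightarrow> (real ^ 'n) set" where
  "minimal_integer_vectors P =
     {z \<in> P \<inter> integer_vectors. \<forall>w \<in> P \<inter> integer_vectors. w \<le> z \<longrightarrow> w = z}"

end

theory Submission
  imports Defs
begin

text \<open>
  A monomial \<open>x^a\<close> lies in \<open>I^k\<close> iff \<open>a\<close> dominates a sum of \<open>k\<close> exponents \<open>v j\<close>, and in the
  closure of \<open>I^k\<close> iff \<open>p a\<close> dominates a sum of \<open>p k\<close> of them for some \<open>p \<ge> 1\<close>. By linear
  programming duality over the rationals, the latter says exactly that \<open>a \<in> k B(Q)\<close>. So \<open>I\<close> is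
  normal iff every integer vector of \<open>k B(Q)\<close> dominates a sum of \<open>k\<close> columns. Adding the surplus
  to one column turns this into an integer decomposition, because \<open>B(Q)\<close> is closed upwards;
  conversely every summand of an integer decomposition dominates a minimal integer vector.
\<close>

section \<open>Linear duality over ordered fields, and clearing of denominators\<close>

text \<open>
  The induction adds one functional \<open>f s\<close> at a time: if the old ones do not suffice, there is
  a \<open>z\<close> with \<open>\<langle>f s, z\<rangle> = 1\<close> that violates the conclusion for them, and projecting along \<open>z\<close> onto
  the kernel of \<open>f s\<close> reduces the claim to the old functionals.
\<close>

lemma farkas:
  fixes f :: "'i \<Rightarrow> 'm::finite \<Rightarrow> 'a::linordered_field"
  assumes "finite S"
    and "\<And>x. \<forall>i\<in>S. (\<Sum>k\<in>UNIV. f i k * x k) \<le> 0 \<Longrightarrow> (\<Sum>k\<in>UNIV. b k * x k) \<le> 0"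
  shows "\<exists>l. (\<forall>i\<in>S. 0 \<le> l i) \<and> (\<forall>k. b k = (\<Sum>i\<in>S. l i * f i k))"
  using assms
proof (induction S arbitrary: f b rule: finite_induct)
  case empty
  \<comment> \<open>With no constraints, \<open>b\<close> itself is a test vector, so its sum of
    squares vanishes.\<close>
  have "(\<Sum>k\<in>UNIV. b k * b k) \<le> 0"
    using empty by simp
  then have "(\<Sum>k\<in>UNIV. b k * b k) = 0"
    by (intro antisym sum_nonneg) auto
  then have "\<forall>k. b k = 0"
    by (subst (asm) sum_nonneg_eq_0_iff) auto
  then show ?case by simp
next
  case (insert s S)
  define dot where "dot = (\<lambda>u x :: 'm \<Rightarrow> 'a. \<Sum>k\<in>UNIV. u k * x k)"
  have dot_left: "dot (\<lambda>k. u k - c * w k) x = dot u x - c * dot w x" for u w x c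
    by (simp add: dot_def algebra_simps sum_subtractf sum_distrib_left)
  have dot_right: "dot u (\<lambda>k. x k - c * y k) = dot u x - c * dot u y" for u x y c
    by (simp add: dot_def algebra_simps sum_subtractf sum_distrib_left)
  have hyp: "dot b x \<le> 0" if "\<And>i. i \<in> insert s S \<Longrightarrow> dot (f i) x \<le> 0" for x
    using insert.prems that unfolding dot_def by blast
  show ?case
  proof (cases "\<forall>x. (\<forall>i\<in>S. dot (f i) x \<le> 0) \<longrightarrow> dot b x \<le> 0")
    case True
    then obtain l where l: "\<forall>i\<in>S. 0 \<le> l i" "\<forall>k. b k = (\<Sum>i\<in>S. l i * f i k)"
      using insert.IH[of f b] unfolding dot_def by blast
    have "(\<Sum>i\<in>S. (l(s := 0)) i * f i k) = (\<Sum>i\<in>S. l i * f i k)" for k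
      using insert.hyps by (intro sum.cong) auto
    with l insert.hyps show ?thesis
      by (intro exI[of _ "l(s := 0)"]) auto
  next
    case False
    then obtain y where y: "\<forall>i\<in>S. dot (f i) y \<le> 0" "dot b y > 0"
      by (auto simp: not_le)
    \<comment> \<open>Otherwise \<open>y\<close> would satisfy every constraint of
      \<open>insert s S\<close> and contradict \<open>hyp\<close>.\<close>
    have sy: "dot (f s) y > 0"
      using hyp[of y] y by fastforce
    \<comment> \<open>This is \<open>y\<close> divided by \<open>dot (f s) y\<close>, written as a
      difference so that \<open>dot_right\<close> applies.\<close>
    define z where "z = (\<lambda>k. 0 - (- inverse (dot (f s) y)) * y k)"
    have dz: "dot u z = dot u y / dot (f s) y" for u
      unfolding z_def by (subst dot_right) (simp add: dot_def field_simps)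
    have z: "\<forall>i\<in>S. dot (f i) z \<le> 0" "dot b z > 0" "dot (f s) z = 1"
      using y sy by (auto simp: dz divide_nonpos_pos)
    \<comment> \<open>\<open>g i\<close> and \<open>c\<close> are \<open>f i\<close> and
      \<open>b\<close> composed with the projection x \<mapsto> x - (f s)(x) z, which is
      \<open>w\<close> below; on \<open>w\<close> the functional \<open>f s\<close>
      vanishes.\<close>
    define g where "g = (\<lambda>i k. f i k - dot (f i) z * f s k)"
    define c where "c = (\<lambda>k. b k - dot b z * f s k)"
    have "dot c x \<le> 0" if x: "\<forall>i\<in>S. dot (g i) x \<le> 0" for x
    proof -
      define w where "w = (\<lambda>k. x k - dot (f s) x * z k)"
      have dw: "dot u w = dot u x - dot u z * dot (f s) x" for u
        unfolding w_def by (subst dot_right) (rule arg_cong[OF mult.commute])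
      have "dot (f i) w \<le> 0" if "i \<in> insert s S" for i
        using x z that by (auto simp: dw g_def dot_left)
      then have "dot b w \<le> 0" by (rule hyp)
      then show ?thesis by (simp add: dw c_def dot_left)
    qed
    then obtain l where l: "\<forall>i\<in>S. 0 \<le> l i" "\<forall>k. c k = (\<Sum>i\<in>S. l i * g i k)"
      using insert.IH[of g c] unfolding dot_def by blast
    \<comment> \<open>Undoing the projection in the identity for \<open>c\<close> collects exactly
      this coefficient at \<open>f s\<close>. It is nonnegative because \<open>b\<close> is positive
      at \<open>z\<close> and every \<open>f i\<close> with i in S is nonpositive there.\<close>
    define t where "t = dot b z - (\<Sum>i\<in>S. l i * dot (f i) z)"
    have "(\<Sum>i\<in>S. l i * dot (f i) z) \<le> 0"
      using l z by (intro sum_nonpos mult_nonneg_nonpos) auto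
    then have "0 \<le> t" using z by (simp add: t_def)
    moreover have "b k = t * f s k + (\<Sum>i\<in>S. l i * f i k)" for k
    proof -
      have "b k = c k + dot b z * f s k"
        by (simp add: c_def)
      also have "c k = (\<Sum>i\<in>S. l i * f i k) - (\<Sum>i\<in>S. l i * dot (f i) z) * f s k"
        by (simp add: l g_def algebra_simps sum_subtractf sum_distrib_left)
      finally show ?thesis by (simp add: t_def algebra_simps)
    qed
    moreover have "(\<Sum>i\<in>S. (l(s := t)) i * f i k) = (\<Sum>i\<in>S. l i * f i k)" for k
      using insert.hyps by (intro sum.cong) auto
    ultimately show ?thesis
      using l insert.hyps by (intro exI[of _ "l(s := t)"]) auto
  qed
qed

lemma sum_UNIV_option: "(\<Sum>x\<in>UNIV. f x) = f None + (\<Sum>x\<in>UNIV. f (Some x))"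
  for f :: "'a::finite option \<Rightarrow> 'b::comm_monoid_add"
  by (simp add: UNIV_option_conv sum.reindex)

text \<open>
  Farkas' lemma is applied to the functionals \<open>(x, t) \<mapsto> t - \<langle>w j, x\<rangle>\<close> and \<open>(x, t) \<mapsto> - x i\<close>;
  the coordinate \<open>None\<close> stands for \<open>t\<close>.
\<close>

lemma covering_duality:
  fixes w :: "'q::finite \<Rightarrow> 'n::finite \<Rightarrow> 'a::linordered_field"
  assumes a: "\<And>i. 0 \<le> a i" and r: "0 \<le> r"
    and cover: "\<And>x. \<lbrakk>\<And>i. 0 \<le> x i; \<And>j. 1 \<le> (\<Sum>i\<in>UNIV. w j i * x i)\<rbrakk>
      \<Longrightarrow> r \<le> (\<Sum>i\<in>UNIV. a i * x i)"
  shows "\<exists>l. (\<forall>j. 0 \<le> l j) \<and> (\<Sum>j\<in>UNIV. l j) = r \<and> (\<forall>i. (\<Sum>j\<in>UNIV. l j * w j i) \<le> a i)"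
proof -
  define f :: "'q + 'n \<Rightarrow> 'n option \<Rightarrow> 'a" where
    "f = case_sum (\<lambda>j. case_option 1 (\<lambda>i. - w j i)) (\<lambda>i k. if k = Some i then - 1 else 0)"
  \<comment> \<open>The functional (x, t) \<mapsto> r t - \<langle>a, x\<rangle>, whose
    nonpositivity is the homogenized form of \<open>cover\<close>.\<close>
  define b where "b = case_option r (\<lambda>i. - a i)"
  have "(\<Sum>k\<in>UNIV. b k * x k) \<le> 0" if x: "\<forall>s\<in>UNIV. (\<Sum>k\<in>UNIV. f s k * x k) \<le> 0" for x
  proof -
    have nonneg: "0 \<le> x (Some i)" for i
    proof -
      have "(\<Sum>k\<in>UNIV. f (Inr i) k * x k) = (\<Sum>k\<in>UNIV. if k = Some i then - x k else 0)"
        by (intro sum.cong) (auto simp: f_def)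
      with bspec[OF x, of "Inr i"] show ?thesis by simp
    qed
    have le: "x None \<le> (\<Sum>i\<in>UNIV. w j i * x (Some i))" for j
      using bspec[OF x, of "Inl j"] by (simp add: f_def sum_UNIV_option sum_negf)
    \<comment> \<open>For t > 0 the point x/t is admissible in \<open>cover\<close>; for t \<le> 0
      the two sides are separated by 0.\<close>
    have "r * x None \<le> (\<Sum>i\<in>UNIV. a i * x (Some i))"
    proof (cases "0 < x None")
      case True
      have "r \<le> (\<Sum>i\<in>UNIV. a i * (x (Some i) / x None))"
        using True nonneg le by (intro cover) (auto simp: sum_divide_distrib[symmetric] pos_le_divide_eq)
      with True show ?thesis
        by (simp add: sum_divide_distrib[symmetric] pos_le_divide_eq)
    next
      case False
      then have "r * x None \<le> 0" using r by (simp add: mult_nonneg_nonpos)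
      also have "0 \<le> (\<Sum>i\<in>UNIV. a i * x (Some i))"
        using a nonneg by (intro sum_nonneg) auto
      finally show ?thesis .
    qed
    then show ?thesis by (simp add: b_def sum_UNIV_option sum_negf)
  qed
  then obtain l where l: "\<forall>s. 0 \<le> l s" "\<And>k. b k = (\<Sum>s\<in>UNIV. l s * f s k)"
    using farkas[of UNIV f b] by auto
  have split: "b k = (\<Sum>j\<in>UNIV. l (Inl j) * f (Inl j) k) + (\<Sum>i\<in>UNIV. l (Inr i) * f (Inr i) k)" for k
    unfolding l(2) UNIV_Plus_UNIV[symmetric] by (subst sum.Plus) auto
  have "(\<Sum>j\<in>UNIV. l (Inl j)) = r"
    using split[of None] by (simp add: f_def b_def)
  \<comment> \<open>The multiplier \<open>l (Inr i)\<close> of the constraint - x i \<le> 0 is the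
    slack in coordinate i.\<close>
  moreover have "(\<Sum>j\<in>UNIV. l (Inl j) * w j i) \<le> a i" for i
  proof -
    have "(\<Sum>i'\<in>UNIV. l (Inr i') * f (Inr i') (Some i)) = - l (Inr i)"
      by (subst sum.mono_neutral_right[of UNIV "{i}"]) (auto simp: f_def)
    then have "a i = (\<Sum>j\<in>UNIV. l (Inl j) * w j i) + l (Inr i)"
      using split[of "Some i"] by (simp add: f_def b_def sum_negf algebra_simps)
    with l(1) show ?thesis by simp
  qed
  ultimately show ?thesis
    using l(1) by (intro exI[of _ "\<lambda>j. l (Inl j)"]) auto
qed

text \<open>The product of the denominators works, built up one factor at a time. This turns
  rational dual weights into integer multiplicities.\<close>

lemma common_denominator:
  fixes l :: "'a \<Rightarrow> rat"
  assumes "finite S" "\<And>j. j \<in> S \<Longrightarrow> 0 \<le> l j"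
  shows "\<exists>p\<ge>1. \<forall>j\<in>S. \<exists>m. of_nat p * l j = of_nat m"
  using assms
proof (induction S rule: finite_induct)
  case empty
  then show ?case by auto
next
  case (insert s S)
  then obtain p where p: "p \<ge> 1" "\<forall>j\<in>S. \<exists>m. of_nat p * l j = of_nat m" by auto
  obtain c d where cd: "quotient_of (l s) = (c, d)" by fastforce
  then have d: "d > 0" "l s = of_int c / of_int d"
    by (auto intro: quotient_of_denom_pos quotient_of_div)
  with insert.prems have c: "c \<ge> 0"
    by (metis insertI1 of_int_0_le_iff of_int_pos zero_le_divide_iff not_le)
  have ls: "of_nat (nat d) * l s = of_nat (nat c)"
    using c d by simp
  have "of_nat (p * nat d) * l s = of_nat (p * nat c)"
    using ls by (simp only: of_nat_mult mult.assoc)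
  moreover have "\<exists>m. of_nat (p * nat d) * l j = of_nat m" if "j \<in> S" for j
  proof -
    from p that obtain m where "of_nat p * l j = of_nat m" by blast
    then have "of_nat (p * nat d) * l j = of_nat (m * nat d)"
      by (simp only: of_nat_mult) (simp add: ac_simps)
    then show ?thesis ..
  qed
  moreover have "p * nat d \<ge> 1" using p d by (simp add: Suc_le_eq)
  ultimately show ?case by blast
qed

section \<open>Exponents that dominate a sum of k generators\<close>

text \<open>Membership of x^a in I^k at the level of exponents. A sequence \<open>g\<close> lets
  generators repeat; only its first k values matter.\<close>

definition dominates_sum :: "('q \<Rightarrow> nat ^ 'n::finite) \<Rightarrow> nat \<Rightarrow> nat ^ 'n \<Rightarrow> bool" where
  "dominates_sum v k a \<longleftrightarrow> (\<exists>g :: nat \<Rightarrow> 'q. (\<Sum>l<k. v (g l)) \<le> a)"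

lemma dominates_sum_mono: "dominates_sum v k a \<Longrightarrow> a \<le> b \<Longrightarrow> dominates_sum v k b"
  unfolding dominates_sum_def using order_trans by blast

lemma dominates_sum_0: "dominates_sum v 0 a"
  by (simp add: dominates_sum_def less_eq_vec_def)

lemma add_mono_vec: "a \<le> c \<Longrightarrow> b \<le> d \<Longrightarrow> a + b \<le> c + d" for a b c d :: "nat ^ 'n"
  by (simp add: less_eq_vec_def add_mono)

text \<open>Splitting off the last generator mirrors the recursion for I^(k+1) as the product of I
  and I^k.\<close>

lemma dominates_sum_Suc:
  "dominates_sum v (Suc k) a \<longleftrightarrow> (\<exists>j b. dominates_sum v k b \<and> v j + b \<le> a)"
proof
  assume "dominates_sum v (Suc k) a"
  then obtain g where "(\<Sum>l<k. v (g l)) + v (g k) \<le> a"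
    by (auto simp: dominates_sum_def)
  then show "\<exists>j b. dominates_sum v k b \<and> v j + b \<le> a"
    unfolding dominates_sum_def by (metis add.commute order_refl)
next
  assume "\<exists>j b. dominates_sum v k b \<and> v j + b \<le> a"
  then obtain j b g where *: "(\<Sum>l<k. v (g l)) \<le> b" "v j + b \<le> a"
    by (auto simp: dominates_sum_def)
  have "(\<Sum>l<k. v ((g(k := j)) l)) = (\<Sum>l<k. v (g l))"
    by (intro sum.cong) auto
  moreover have "(\<Sum>l<k. v (g l)) + v j \<le> a"
    using add_mono_vec[OF order_refl *(1), of "v j"] *(2) by (simp add: add.commute)
  ultimately have "(\<Sum>l<Suc k. v ((g(k := j)) l)) \<le> a"
    by simp
  then show "dominates_sum v (Suc k) a"
    unfolding dominates_sum_def by blast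
qed

text \<open>Multiplicities \<open>c j\<close> are unrolled into a sequence of generators: each step
  removes one copy of some \<open>v j\<close> with \<open>c j > 0\<close>.\<close>

lemma dominates_sum_weights:
  fixes v :: "'q::finite \<Rightarrow> nat ^ 'n::finite"
  assumes "(\<Sum>j\<in>UNIV. c j) = k" "\<And>i. (\<Sum>j\<in>UNIV. c j * v j $ i) \<le> a $ i"
  shows "dominates_sum v k a"
  using assms
proof (induction k arbitrary: c a)
  case 0
  show ?case by (rule dominates_sum_0)
next
  case (Suc k)
  then obtain j where j: "c j > 0"
    by (metis not_gr_zero sum.neutral Zero_not_Suc)
  \<comment> \<open>The subtraction on naturals is exact since \<open>c j > 0\<close>.\<close>
  have eq: "c l = (c(j := c j - 1)) l + (if l = j then 1 else 0)" for l
    using j by auto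
  have "(\<Sum>l\<in>UNIV. c l) = (\<Sum>l\<in>UNIV. (c(j := c j - 1)) l) + 1"
    by (subst eq) (simp only: sum.distrib sum.delta finite UNIV_I if_True)
  then have k: "(\<Sum>l\<in>UNIV. (c(j := c j - 1)) l) = k"
    using Suc.prems(1) by simp
  define b where "b = (\<chi> i. \<Sum>l\<in>UNIV. (c(j := c j - 1)) l * v l $ i)"
  have "(\<Sum>l\<in>UNIV. c l * v l $ i) = b $ i + v j $ i" for i
  proof -
    have "c l * v l $ i = (c(j := c j - 1)) l * v l $ i + (if l = j then v l $ i else 0)" for l
      by (subst eq) (simp add: algebra_simps)
    then have "(\<Sum>l\<in>UNIV. c l * v l $ i)
        = (\<Sum>l\<in>UNIV. (c(j := c j - 1)) l * v l $ i + (if l = j then v l $ i else 0))"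
      by (intro sum.cong) auto
    then show ?thesis
      by (simp only: b_def vec_lambda_beta sum.distrib sum.delta finite UNIV_I if_True)
  qed
  then have "v j + b \<le> a"
    using Suc.prems(2) by (simp add: less_eq_vec_def add.commute)
  moreover have "dominates_sum v k b"
    by (rule Suc.IH[OF k]) (simp only: b_def vec_lambda_beta order_refl)
  ultimately show ?case unfolding dominates_sum_Suc by blast
qed


section \<open>Monomial ideals, their powers and normality in terms of exponents\<close>

lemma sum_monomials: "f = (\<Sum>m\<in>Poly_Mapping.keys f. Poly_Mapping.single m (Poly_Mapping.lookup f m))"
  by (rule poly_mapping_eqI) (simp add: lookup_sum lookup_single when_def in_keys_iff)

text \<open>The right side is an ideal, because a key of f + g is a key of f or g and a key of f g
  is a sum of keys. Conversely, each term of such an f is a multiple of a generator.\<close>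

lemma ideal_gen_xpow:
  fixes S :: "(nat ^ 'n::finite) set"
  shows "ideal_gen (xpow ` S) = {f :: ('k::field, 'n) mpoly. \<forall>m\<in>Poly_Mapping.keys f. \<exists>s\<in>S. s \<le> m}"
    (is "_ = ?M")
proof
  have "module.subspace (*) ?M"
    unfolding module.subspace_def[OF module_self]
  proof (intro conjI ballI allI)
    fix f g :: "('k, 'n) mpoly"
    assume "f \<in> ?M" "g \<in> ?M"
    then show "f + g \<in> ?M"
      using keys_add[of f g] by blast
  next
    fix f g :: "('k, 'n) mpoly"
    assume g: "g \<in> ?M"
    show "f * g \<in> ?M"
    proof (clarify)
      fix m assume "m \<in> Poly_Mapping.keys (f * g)"
      then obtain a b where m: "m = a + b" "b \<in> Poly_Mapping.keys g"
        using keys_mult[of f g] by blast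
      with g obtain s where "s \<in> S" "s \<le> b" by blast
      with m show "\<exists>s\<in>S. s \<le> m"
        by (intro bexI[of _ s]) (auto simp: less_eq_vec_def trans_le_add2)
    qed
  qed simp
  moreover have "xpow ` S \<subseteq> ?M"
    by (auto simp: xpow_eq_single)
  ultimately show "ideal_gen (xpow ` S) \<subseteq> ?M"
    unfolding ideal_gen_def by (intro module.span_minimal[OF module_self])
next
  show "?M \<subseteq> ideal_gen (xpow ` S)"
  proof
    fix f :: "('k, 'n) mpoly" assume f: "f \<in> ?M"
    have "Poly_Mapping.single m c \<in> ideal_gen (xpow ` S)"
      if "m \<in> Poly_Mapping.keys f" for m and c :: 'k
    proof -
      from f that obtain s where s: "s \<in> S" "s \<le> m" by blast
      then have "m - s + s = m" by (simp add: less_eq_vec_def vec_eq_iff)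
      then have "Poly_Mapping.single m c = Poly_Mapping.single (m - s) c * xpow s"
        by (simp add: xpow_eq_single mult_single)
      with s show ?thesis
        unfolding ideal_gen_def
        by (simp add: module.span_scale[OF module_self] module.span_base[OF module_self])
    qed
    then show "f \<in> ideal_gen (xpow ` S)"
      unfolding ideal_gen_def
      by (subst sum_monomials) (intro module.span_sum[OF module_self])
  qed
qed

text \<open>In the induction step, the products generating I^(k+1) and the monomials with exponents
  in \<open>T\<close> lie in each other's span; the latter span is known from
  \<open>ideal_gen_xpow\<close>.\<close>

lemma ideal_power_xpow:
  fixes v :: "'q::finite \<Rightarrow> nat ^ 'n::finite"
  defines "I \<equiv> ideal_gen (range (\<lambda>j. xpow (v j))) :: ('k::field, 'n) mpoly set"
  shows "ideal_power I k = {f. \<forall>m\<in>Poly_Mapping.keys f. dominates_sum v k m}"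
proof (induction k)
  case 0
  show ?case by (simp add: dominates_sum_0)
next
  case (Suc k)
  have I: "I = {f. \<forall>m\<in>Poly_Mapping.keys f. \<exists>j. v j \<le> m}"
    using ideal_gen_xpow[of "range v"] unfolding I_def by (simp add: image_image)
  define T where "T = {m. dominates_sum v (Suc k) m}"
  define P where "P = {f * g | f g. f \<in> I \<and> g \<in> ideal_power I k}"
  have T: "ideal_gen (xpow ` T) = {f :: ('k, 'n) mpoly. \<forall>m\<in>Poly_Mapping.keys f. dominates_sum v (Suc k) m}"
    unfolding ideal_gen_xpow by (auto simp: T_def intro: dominates_sum_mono)
  have "xpow ` T \<subseteq> ideal_gen P"
  proof clarify
    fix m assume "m \<in> T"
    then obtain j b where b: "dominates_sum v k b" "v j + b \<le> m"
      unfolding T_def dominates_sum_Suc by blast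
    then have "v j $ i + b $ i \<le> m $ i" for i
      by (simp add: less_eq_vec_def)
    \<comment> \<open>Since \<open>v j\<close> \<le> m in each coordinate, the truncated difference
      \<open>m - v j\<close> is a true one.\<close>
    from add_leD1[OF this] add_le_imp_le_diff[OF this[unfolded add.commute[of "v j $ _"]]]
    have "m - v j + v j = m" "b \<le> m - v j"
      by (simp_all add: less_eq_vec_def vec_eq_iff)
    moreover from this b have "xpow (m - v j) \<in> ideal_power I k"
      by (auto simp: Suc xpow_eq_single intro: dominates_sum_mono)
    moreover have "xpow (v j) \<in> I"
      by (auto simp: I xpow_eq_single)
    ultimately have "xpow (v j) * xpow (m - v j) \<in> P" "xpow m = (xpow (v j) * xpow (m - v j) :: ('k, 'n) mpoly)"
      unfolding P_def by (blast, simp add: xpow_eq_single mult_single add.commute)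
    then show "xpow m \<in> ideal_gen P"
      unfolding ideal_gen_def by (simp add: module.span_base[OF module_self])
  qed
  moreover have "P \<subseteq> ideal_gen (xpow ` T)"
  proof
    fix h assume "h \<in> P"
    then obtain f g where h: "h = f * g" "f \<in> I" "g \<in> ideal_power I k"
      unfolding P_def by blast
    have "dominates_sum v (Suc k) m" if m_in: "m \<in> Poly_Mapping.keys h" for m
    proof -
      obtain a b where m: "m = a + b" "a \<in> Poly_Mapping.keys f" "b \<in> Poly_Mapping.keys g"
        using m_in keys_mult[of f g] h by blast
      then obtain j where "v j \<le> a" "dominates_sum v k b"
        using h(2,3) m(2,3) unfolding Suc by (auto simp: I)
      with m show ?thesis
        unfolding dominates_sum_Suc using add_mono_vec by blast
    qed
    then show "h \<in> ideal_gen (xpow ` T)" by (simp add: T)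
  qed
  ultimately have "ideal_gen P = ideal_gen (xpow ` T)"
    unfolding ideal_gen_def
    by (intro antisym module.span_minimal[OF module_self] module.subspace_span[OF module_self])
  then show ?case by (simp add: T ideal_mult_def P_def)
qed

lemma xpow_power: "xpow a ^ p = (xpow (p *s a) :: ('k::field, 'n::finite) mpoly)"
proof (induction p)
  case 0
  have "0 *s a = 0" by (simp add: vec_eq_iff)
  then show ?case by (simp add: xpow_eq_single)
next
  case (Suc p)
  have "a + p *s a = Suc p *s a" by (simp add: vec_eq_iff)
  with Suc show ?case by (simp add: xpow_eq_single mult_single)
qed

text \<open>Both I^k and its closure are determined by the exponents of their monomials, so
  comparing the ideals amounts to comparing two sets of exponents.\<close>

lemma normal_ideal_iff:
  fixes v :: "'q::finite \<Rightarrow> nat ^ 'n::finite"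
  defines "I \<equiv> ideal_gen (range (\<lambda>j. xpow (v j))) :: ('k::field, 'n) mpoly set"
  shows "normal_ideal I \<longleftrightarrow>
    (\<forall>k\<ge>1. \<forall>a. (\<exists>p\<ge>1. dominates_sum v (p * k) (p *s a)) \<longrightarrow> dominates_sum v k a)"
proof -
  have pow: "ideal_power I k = {f. \<forall>m\<in>Poly_Mapping.keys f. dominates_sum v k m}" for k
    unfolding I_def by (rule ideal_power_xpow)
  have mem: "xpow a \<in> ideal_power I k \<longleftrightarrow> dominates_sum v k a" for a k
    by (simp add: pow xpow_eq_single)
  have closure: "integral_closure_power I k =
      {f. \<forall>m\<in>Poly_Mapping.keys f. \<exists>p\<ge>1. dominates_sum v (p * k) (p *s m)}" for k
  proof -
    have "integral_closure_power I k =
        ideal_gen (xpow ` {a. \<exists>p\<ge>1. dominates_sum v (p * k) (p *s a)})"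
      unfolding integral_closure_power_def
      by (simp only: xpow_power mem image_Collect)
    also have "\<dots> = {f. \<forall>m\<in>Poly_Mapping.keys f. \<exists>p\<ge>1. dominates_sum v (p * k) (p *s m)}"
    proof -
      \<comment> \<open>The exponents of the closure form an upward closed set, so lying above one
        of them is the same as being one.\<close>
      have "p *s a \<le> p *s b" if "a \<le> b" for p :: nat and a b :: "nat ^ 'n"
        using that by (simp add: less_eq_vec_def)
      then have "(\<exists>s\<in>{a. \<exists>p\<ge>1. dominates_sum v (p * k) (p *s a)}. s \<le> m) \<longleftrightarrow>
          (\<exists>p\<ge>1. dominates_sum v (p * k) (p *s m))" for m
        using dominates_sum_mono by blast
      then show ?thesis unfolding ideal_gen_xpow by simp
    qed
    finally show ?thesis .
  qed
  \<comment> \<open>With p = 1 this puts I^k inside its closure; normality is then the reverse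
    inclusion.\<close>
  have triv: "\<exists>p\<ge>1. dominates_sum v (p * k) (p *s a)" if "dominates_sum v k a" for k a
  proof -
    have "1 *s a = a" by (simp add: vec_eq_iff)
    with that show ?thesis by (intro exI[of _ 1]) simp
  qed
  show ?thesis
  proof
    assume n: "normal_ideal I"
    show "\<forall>k\<ge>1. \<forall>a. (\<exists>p\<ge>1. dominates_sum v (p * k) (p *s a)) \<longrightarrow> dominates_sum v k a"
    proof (intro allI impI)
      fix k :: nat and a
      assume k: "k \<ge> 1" and a: "\<exists>p\<ge>1. dominates_sum v (p * k) (p *s a)"
      then have "xpow a \<in> integral_closure_power I k"
        by (simp add: closure xpow_eq_single)
      with n k show "dominates_sum v k a"
        unfolding normal_ideal_def mem[symmetric] by blast
    qed
  next
    assume "\<forall>k\<ge>1. \<forall>a. (\<exists>p\<ge>1. dominates_sum v (p * k) (p *s a)) \<longrightarrow> dominates_sum v k a"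
    with triv show "normal_ideal I"
      unfolding normal_ideal_def pow closure by blast
  qed
qed

section \<open>Integer points of the blocking polyhedron and its multiples\<close>

definition real_vec :: "nat ^ 'n \<Rightarrow> real ^ 'n" where
  "real_vec a = (\<chi> i. real (a $ i))"

lemma real_vec_nth [simp]: "real_vec a $ i = real (a $ i)"
  by (simp add: real_vec_def)

lemma real_vec_le_iff [simp]: "real_vec a \<le> real_vec b \<longleftrightarrow> a \<le> b"
  by (simp add: less_eq_vec_def)

lemma real_vec_add: "real_vec (a + b) = real_vec a + real_vec b"
  by (simp add: vec_eq_iff)

lemma real_vec_sum: "real_vec (\<Sum>l\<in>S. f l) = (\<Sum>l\<in>S. real_vec (f l))"
  by (simp add: vec_eq_iff)

lemma integer_vector_real_vec:
  assumes "z \<in> integer_vectors" "0 \<le> z"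
  obtains a where "z = real_vec a"
proof
  show "z = real_vec (\<chi> i. nat \<lfloor>z $ i\<rfloor>)"
    using assms by (auto simp: integer_vectors_def less_eq_vec_def vec_eq_iff of_nat_nat elim!: Ints_cases)
qed

lemma real_vec_integer: "real_vec a \<in> integer_vectors"
  by (simp add: integer_vectors_def)

lemma inner_mono_vec: "u \<le> w \<Longrightarrow> 0 \<le> x \<Longrightarrow> u \<bullet> x \<le> w \<bullet> x"
  for u w x :: "real ^ 'n::finite"
  by (auto simp: inner_vec_def less_eq_vec_def intro!: sum_mono mult_right_mono)

lemma covering_polyhedron_columns:
  "covering_polyhedron A = {x. 0 \<le> x \<and> (\<forall>j. 1 \<le> column j A \<bullet> x)}"
  by (auto simp: covering_polyhedron_def less_eq_vec_def vector_matrix_mult_def column_def inner_vec_def mult.commute)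

text \<open>Points of the covering polyhedron are nonnegative, so enlarging z can only increase its
  inner products with them.\<close>

lemma blocking_polyhedron_upward:
  assumes "z \<in> blocking_polyhedron (covering_polyhedron A)" "z \<le> w"
  shows "w \<in> blocking_polyhedron (covering_polyhedron A)"
  using assms inner_mono_vec[of z w]
  unfolding blocking_polyhedron_def covering_polyhedron_columns by fastforce

lemma column_in_blocking:
  fixes A :: "real ^ 'q ^ 'n"
  assumes "0 \<le> column j A"
  shows "column j A \<in> blocking_polyhedron (covering_polyhedron A)"
  using assms unfolding blocking_polyhedron_def covering_polyhedron_columns by auto

lemma scaled_blocking_iff:
  assumes "k \<ge> 1" "0 \<le> z"
  shows "z \<in> (\<lambda>y. real k *\<^sub>R y) ` blocking_polyhedron Q \<longleftrightarrow> (\<forall>x\<in>Q. real k \<le> z \<bullet> x)"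
proof
  assume "z \<in> (\<lambda>y. real k *\<^sub>R y) ` blocking_polyhedron Q"
  then obtain y where "z = real k *\<^sub>R y" "\<forall>x\<in>Q. 1 \<le> y \<bullet> x"
    by (auto simp: blocking_polyhedron_def)
  then show "\<forall>x\<in>Q. real k \<le> z \<bullet> x"
    by (auto simp: mult_le_cancel_left1)
next
  assume *: "\<forall>x\<in>Q. real k \<le> z \<bullet> x"
  have "(1 / real k) *\<^sub>R z \<in> blocking_polyhedron Q"
    using assms * by (auto simp: blocking_polyhedron_def less_eq_vec_def)
  moreover have "z = real k *\<^sub>R ((1 / real k) *\<^sub>R z)"
    using assms by simp
  ultimately show "z \<in> (\<lambda>y. real k *\<^sub>R y) ` blocking_polyhedron Q" by blast
qed

text \<open>Links k B(Q) to the integral closure of I^k: duality gives rational column weights of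
  total k, and p is a common denominator of them.\<close>

lemma scaled_blocking_dominates_iff:
  fixes v :: "'q::finite \<Rightarrow> nat ^ 'n::finite" and A :: "real ^ 'q ^ 'n"
  assumes A: "\<And>j. column j A = real_vec (v j)" and k: "k \<ge> 1"
  shows "real_vec a \<in> (\<lambda>y. real k *\<^sub>R y) ` blocking_polyhedron (covering_polyhedron A) \<longleftrightarrow>
    (\<exists>p\<ge>1. dominates_sum v (p * k) (p *s a))"
proof -
  have "(\<forall>x\<in>covering_polyhedron A. real k \<le> real_vec a \<bullet> x) \<longleftrightarrow>
    (\<exists>p\<ge>1. dominates_sum v (p * k) (p *s a))"
  proof
    assume cover: "\<forall>x\<in>covering_polyhedron A. real k \<le> real_vec a \<bullet> x"
    \<comment> \<open>Duality is applied over \<open>rat\<close> to obtain rational weights; it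
      tests only rational points, which embed into the real covering polyhedron.\<close>
    have "\<exists>l :: 'q \<Rightarrow> rat. (\<forall>j. 0 \<le> l j) \<and> (\<Sum>j\<in>UNIV. l j) = of_nat k \<and>
        (\<forall>i. (\<Sum>j\<in>UNIV. l j * of_nat (v j $ i)) \<le> of_nat (a $ i))"
    proof (rule covering_duality)
      fix x :: "'n \<Rightarrow> rat"
      assume x: "\<And>i. 0 \<le> x i" "\<And>j. 1 \<le> (\<Sum>i\<in>UNIV. of_nat (v j $ i) * x i)"
      define y :: "real ^ 'n" where "y = (\<chi> i. of_rat (x i))"
      have inner: "real_vec b \<bullet> y = of_rat (\<Sum>i\<in>UNIV. of_nat (b $ i) * x i)" for b
        by (simp add: y_def inner_vec_def of_rat_sum of_rat_mult)
      have "y \<in> covering_polyhedron A"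
        using x by (simp add: covering_polyhedron_columns A inner)
          (simp add: y_def less_eq_vec_def)
      with cover have "of_rat (of_nat k) \<le> real_vec a \<bullet> y" by simp
      then show "of_nat k \<le> (\<Sum>i\<in>UNIV. of_nat (a $ i) * x i)"
        unfolding inner of_rat_less_eq .
    qed simp_all
    then obtain l :: "'q \<Rightarrow> rat" where l: "\<And>j. 0 \<le> l j" "(\<Sum>j\<in>UNIV. l j) = of_nat k"
        "\<And>i. (\<Sum>j\<in>UNIV. l j * of_nat (v j $ i)) \<le> of_nat (a $ i)" by blast
    obtain p where p: "p \<ge> 1" "\<forall>j. \<exists>m. of_nat p * l j = of_nat m"
      using common_denominator[of UNIV l] l(1) by auto
    then obtain c where c: "\<And>j. of_nat p * l j = of_nat (c j)" by metis
    have "of_nat (\<Sum>j\<in>UNIV. c j) = (of_nat (p * k) :: rat)"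
      by (simp add: c[symmetric] sum_distrib_left[symmetric] l(2))
    moreover have "of_nat (\<Sum>j\<in>UNIV. c j * v j $ i) \<le> (of_nat ((p *s a) $ i) :: rat)" for i
    proof -
      have "of_nat (\<Sum>j\<in>UNIV. c j * v j $ i) = of_nat p * (\<Sum>j\<in>UNIV. l j * of_nat (v j $ i))"
        by (simp add: c[symmetric] sum_distrib_left mult.assoc)
      also have "\<dots> \<le> of_nat p * of_nat (a $ i)"
        by (intro mult_left_mono l) simp
      finally show ?thesis by simp
    qed
    ultimately have "dominates_sum v (p * k) (p *s a)"
      unfolding of_nat_eq_iff of_nat_le_iff by (rule dominates_sum_weights)
    with p show "\<exists>p\<ge>1. dominates_sum v (p * k) (p *s a)" by blast
  next
    assume "\<exists>p\<ge>1. dominates_sum v (p * k) (p *s a)"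
    then obtain p g where p: "p \<ge> 1" and g: "(\<Sum>l<p * k. v (g l)) \<le> p *s a"
      by (auto simp: dominates_sum_def)
    show "\<forall>x\<in>covering_polyhedron A. real k \<le> real_vec a \<bullet> x"
    proof
      fix x assume x: "x \<in> covering_polyhedron A"
      have "real (p * k) = (\<Sum>l<p * k. 1)" by simp
      \<comment> \<open>Each of the p k columns has inner product at least 1 with x; the factor p
        cancels at the end.\<close>
      also have "\<dots> \<le> (\<Sum>l<p * k. real_vec (v (g l)) \<bullet> x)"
        using x by (intro sum_mono) (simp add: covering_polyhedron_columns A)
      also have "\<dots> = real_vec (\<Sum>l<p * k. v (g l)) \<bullet> x"
        by (simp add: real_vec_sum inner_sum_left)
      also have "\<dots> \<le> real_vec (p *s a) \<bullet> x"
        using x g by (intro inner_mono_vec) (auto simp: covering_polyhedron_def)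
      also have "real_vec (p *s a) = real p *\<^sub>R real_vec a"
        by (simp add: vec_eq_iff)
      finally show "real k \<le> real_vec a \<bullet> x" using p by simp
    qed
  qed
  moreover have "0 \<le> real_vec a" by (simp add: less_eq_vec_def)
  ultimately show ?thesis using scaled_blocking_iff[OF k] by blast
qed

text \<open>Descent on the coordinate sum: a non-minimal vector has a different integer vector of
  B(Q) below it, which is again natural and has smaller sum.\<close>

lemma minimal_integer_vector_below:
  fixes Q :: "(real ^ 'n::finite) set"
  assumes "real_vec a \<in> blocking_polyhedron Q"
  shows "\<exists>b. real_vec b \<in> minimal_integer_vectors (blocking_polyhedron Q) \<and> b \<le> a"
  using assms
proof (induction "\<Sum>i\<in>UNIV. a $ i" arbitrary: a rule: less_induct)
  case less
  show ?case
  proof (cases "real_vec a \<in> minimal_integer_vectors (blocking_polyhedron Q)")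
    case True
    then show ?thesis by blast
  next
    case False
    then obtain w where w: "w \<in> blocking_polyhedron Q" "w \<in> integer_vectors" "w \<le> real_vec a" "w \<noteq> real_vec a"
      using less.prems real_vec_integer by (auto simp: minimal_integer_vectors_def)
    moreover from w have "0 \<le> w" by (simp add: blocking_polyhedron_def)
    ultimately obtain b where b: "w = real_vec b" using integer_vector_real_vec by blast
    with w have ba: "b \<le> a" "b \<noteq> a" by auto
    then obtain i where "b $ i < a $ i"
      by (auto simp: less_eq_vec_def vec_eq_iff order.order_iff_strict)
    with ba have "(\<Sum>i\<in>UNIV. b $ i) < (\<Sum>i\<in>UNIV. a $ i)"
      by (intro sum_strict_mono_ex1) (auto simp: less_eq_vec_def)
    with less.hyps b w ba show ?thesis using order_trans by blast
  qed
qed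

section \<open>Normality against integer decomposition and minimal integer vectors\<close>

theorem theorem1p1p2:
  fixes v :: "'q::finite \<Rightarrow> nat ^ 'n::finite"
    and A :: "nat ^ 'q ^ 'n"
    and I :: "('k::field, 'n) mpoly set"
    and AR :: "real ^ 'q ^ 'n"
  assumes A: "\<And>j. column j A = v j"
    and rows: "\<And>i. row i A \<noteq> 0"
    and cols: "\<And>j. column j A \<noteq> 0"
    and I: "I = ideal_gen (range (\<lambda>j. xpow (v j)))"
    and AR: "AR = map_matrix real A"
  shows "normal_ideal I \<longleftrightarrow>
    integer_decomposition_property (blocking_polyhedron (covering_polyhedron AR)) \<and>
    minimal_integer_vectors (blocking_polyhedron (covering_polyhedron AR)) \<subseteq> columns AR"
proof -
  define B where "B = blocking_polyhedron (covering_polyhedron AR)"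
  have col: "column j AR = real_vec (v j)" for j
    using A[of j] by (auto simp: AR column_def vec_eq_iff)
  note scaled = scaled_blocking_dominates_iff[of AR v, OF col, folded B_def]
  have nonneg: "0 \<le> z" if "z \<in> B" for z
    using that by (simp add: B_def blocking_polyhedron_def)
  have vB: "real_vec (v j) \<in> B" for j
    using column_in_blocking[of j AR] by (simp add: B_def col less_eq_vec_def)
  have up: "w \<in> B" if "z \<in> B" "z \<le> w" for z w
    using blocking_polyhedron_upward that unfolding B_def by blast
  have normal: "normal_ideal I \<longleftrightarrow>
      (\<forall>k\<ge>1. \<forall>a. real_vec a \<in> (\<lambda>y. real k *\<^sub>R y) ` B \<longrightarrow> dominates_sum v k a)"
    unfolding I normal_ideal_iff using scaled by auto
  have "normal_ideal I \<longleftrightarrow>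
      integer_decomposition_property B \<and> minimal_integer_vectors B \<subseteq> columns AR"
    unfolding normal
  proof (intro iffI conjI)
    assume dom: "\<forall>k\<ge>1. \<forall>a. real_vec a \<in> (\<lambda>y. real k *\<^sub>R y) ` B \<longrightarrow> dominates_sum v k a"
    show "integer_decomposition_property B"
      unfolding integer_decomposition_property_def
    proof (intro allI impI, elim conjE)
      fix k :: nat and z
      assume k: "1 \<le> k" and z: "z \<in> integer_vectors" "z \<in> (\<lambda>y. real k *\<^sub>R y) ` B"
      have "0 \<le> z"
        using z(2) nonneg by (auto simp: less_eq_vec_def)
      then obtain a where a: "z = real_vec a"
        using z integer_vector_real_vec by blast
      then obtain g where g: "(\<Sum>l<k. v (g l)) \<le> a"
        using dom k z by (auto simp: dominates_sum_def)
      obtain k' where k': "k = Suc k'" using k by (cases k) auto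
      define d where "d = a - (\<Sum>l<k. v (g l))"
      have ad: "a = (\<Sum>l<k. v (g l)) + d"
        using g by (simp add: d_def less_eq_vec_def vec_eq_iff)
      \<comment> \<open>The whole surplus \<open>d\<close> goes to the last summand, with index
        \<open>k'\<close> = k - 1, which exists because k \<ge> 1.\<close>
      define b where "b l = real_vec (if l = k' then v (g l) + d else v (g l))" for l
      have "b l \<in> integer_vectors \<inter> B" for l
      proof -
        have "real_vec (v (g l)) \<le> b l"
          by (simp add: b_def less_eq_vec_def)
        then have "b l \<in> B" by (rule up[OF vB])
        moreover have "b l \<in> integer_vectors" by (simp add: b_def real_vec_integer)
        ultimately show ?thesis by blast
      qed
      moreover have "z = (\<Sum>l<k. b l)"
        by (simp add: a ad k' b_def real_vec_sum real_vec_add add.assoc)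
      ultimately show "\<exists>b. (\<forall>j<k. b j \<in> integer_vectors \<inter> B) \<and> z = (\<Sum>j<k. b j)"
        by (intro exI[of _ b]) simp
    qed
    show "minimal_integer_vectors B \<subseteq> columns AR"
    proof
      fix z assume z: "z \<in> minimal_integer_vectors B"
      then have "z \<in> B" "z \<in> integer_vectors"
        and min: "\<And>w. \<lbrakk>w \<in> B; w \<in> integer_vectors; w \<le> z\<rbrakk> \<Longrightarrow> w = z"
        by (auto simp: minimal_integer_vectors_def)
      then obtain a where a: "z = real_vec a"
        using nonneg integer_vector_real_vec by blast
      \<comment> \<open>The case k = 1 puts a column below z; the column lies in B, so minimality
        forces equality.\<close>
      have "dominates_sum v 1 a"
        using dom \<open>z \<in> B\<close> a by fastforce
      then obtain j where "v j \<le> a" by (auto simp: dominates_sum_def)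
      then have "column j AR = z"
        using min[OF vB real_vec_integer] a by (simp add: col)
      then show "z \<in> columns AR" by (auto simp: columns_def)
    qed
  next
    assume R: "integer_decomposition_property B \<and> minimal_integer_vectors B \<subseteq> columns AR"
    show "\<forall>k\<ge>1. \<forall>a. real_vec a \<in> (\<lambda>y. real k *\<^sub>R y) ` B \<longrightarrow> dominates_sum v k a"
    proof (intro allI impI)
      fix k :: nat and a
      assume "k \<ge> 1" "real_vec a \<in> (\<lambda>y. real k *\<^sub>R y) ` B"
      then obtain b where b: "\<forall>l<k. b l \<in> integer_vectors \<inter> B" "real_vec a = (\<Sum>l<k. b l)"
        using R real_vec_integer unfolding integer_decomposition_property_def by blast
      \<comment> \<open>Below each summand lies a minimal integer vector of B, which by assumption
        is a column.\<close>
      have "\<exists>j. real_vec (v j) \<le> b l" if l: "l < k" for l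
      proof -
        obtain c where c: "b l = real_vec c" "real_vec c \<in> B"
          using b(1) l nonneg integer_vector_real_vec by (metis IntE)
        then obtain c' where "real_vec c' \<in> minimal_integer_vectors B" "c' \<le> c"
          using minimal_integer_vector_below unfolding B_def by blast
        moreover from this R obtain j where "real_vec c' = real_vec (v j)"
          by (auto simp: columns_def col)
        ultimately show ?thesis using c by (metis real_vec_le_iff)
      qed
      then obtain g where g: "\<And>l. l < k \<Longrightarrow> real_vec (v (g l)) \<le> b l" by metis
      have "real_vec (\<Sum>l<k. v (g l)) \<le> real_vec a"
        unfolding b(2) real_vec_sum using g by (auto simp: less_eq_vec_def intro!: sum_mono)
      then show "dominates_sum v k a" by (auto simp: dominates_sum_def)
    qed
  qed
  then show ?thesis by (simp add: B_def)
qed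

end
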